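(* There exists an instance (with a credible agent) where an optimal $\widetilde{\mathsf{E}}\mathsf{SES}$ mechanism yields a strictly higher expected payoff for the principal than any $\mathsf{SES}$ mechanism.
   Context: An instance consists of finite sets $\Theta$ (states), $A$ (actions), $T$ (agent types), a prior $\mu\in\Delta(\Theta)$, a type distribution $\rho\in\Delta(T)$, a principal payoff function $v(\theta,a)$ and agent payoff functions $u_t(\theta,a)$, $t\in T$. The state $\theta\sim\mu$ is observed only by the principal; the agent's type $t\sim\rho$, independent of $\theta$, is known only to the agent. The principal commits to a mechanism. $\mathsf{SES}$ mechanism: the principal first sends a pre-signal $g'\sim\pi(\cdot\mid\theta)$, $\pi:\Theta\to\Delta(G')$ with $G'$ finite; the agent, having observed $g'$, reports a type $t'\in T$ (binding elicitation); the principal sends $g\sim\pi_{g',t'}(\cdot\mid\theta)$ from a finite signal set; then the agent plays an action $a$. $\widetilde{\mathsf{E}}\mathsf{SES}$ mechanism: there is an additional first stage of non-binding elicitation, where the agent selects one option from a finite menu; depending on the selected option the principal proceeds with a corresponding $\mathsf{SES}$ mechanism. The selected option imposes no restriction on the agent's subsequent behavior. The principal gets $v(\theta,a)$ and an agent of true type $t$ gets $u_t(\theta,a)$. The agent is credible: after reporting type $t'$ in the binding elicitation he must play an action maximizing the expectation of $u_{t'}(\theta,\cdot)$ under his posterior belief about $\theta$ given all received signals, even if $t'\neq t$. He makes all his choices (option, report) to maximize his expected payoff under his true payoff function $u_t$. Ties are broken as the mechanism decides. *)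

theory Defs
  imports "HOL-Probability.Probability_Mass_Function"
begin

record ('s, 'a, 't) persuasion =
  states :: "'s set"
  actions :: "'a set"
  types :: "'t set"
  prior :: "'s pmf"
  type_dist :: "'t pmf"
  principal_util :: "'s \<Rightarrow> 'a \<Rightarrow> real"
  agent_util :: "'t \<Rightarrow> 's \<Rightarrow> 'a \<Rightarrow> real"

definition persuasion_instance :: "('s, 'a, 't) persuasion \<Rightarrow> bool" where
  "persuasion_instance I \<longleftrightarrow>
     finite (states I) \<and> finite (actions I) \<and> actions I \<noteq> {} \<and> finite (types I) \<and>
     set_pmf (prior I) \<subseteq> states I \<and> set_pmf (type_dist I) \<subseteq> types I"

text \<open>A mechanism of the form signal, (binding) elicit, signal. Signals are labelled by natural
  numbers, which loses nothing since the signal sets are finite. The last two fields say how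
  the mechanism breaks ties: \<open>report S t g'\<close> is the report made by an agent of true type
  \<open>t\<close> after the pre-signal \<open>g'\<close>, and \<open>act S g' t' g\<close> is the action played after
  pre-signal \<open>g'\<close>, report \<open>t'\<close> and signal \<open>g\<close>. The constraint that both are optimal
  choices is part of \<open>is_ses\<close> below.\<close>

record ('s, 'a, 't) ses =
  pre_signals :: "nat set"
  pre_signal :: "'s \<Rightarrow> nat pmf"
  signals :: "nat set"
  signal :: "nat \<Rightarrow> 't \<Rightarrow> 's \<Rightarrow> nat pmf"
  report :: "'t \<Rightarrow> nat \<Rightarrow> 't"
  act :: "nat \<Rightarrow> 't \<Rightarrow> nat \<Rightarrow> 'a"

text \<open>Bayes' rule. At a signal of probability zero the result is the zero function
  (division by zero), under which every choice has expected payoff 0; hence the optimality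
  conditions below are void at unreachable signals.\<close>

definition posterior ::
    "'s set \<Rightarrow> ('s \<Rightarrow> real) \<Rightarrow> ('s \<Rightarrow> nat pmf) \<Rightarrow> nat \<Rightarrow> 's \<Rightarrow> real" where
  "posterior \<Theta> p \<kappa> g \<theta> =
     p \<theta> * pmf (\<kappa> \<theta>) g / (\<Sum>\<theta>'\<in>\<Theta>. p \<theta>' * pmf (\<kappa> \<theta>') g)"

definition interim_belief ::
    "('s, 'a, 't) persuasion \<Rightarrow> ('s, 'a, 't) ses \<Rightarrow> nat \<Rightarrow> 's \<Rightarrow> real" where
  "interim_belief I S g' = posterior (states I) (pmf (prior I)) (pre_signal S) g'"

definition final_belief ::
    "('s, 'a, 't) persuasion \<Rightarrow> ('s, 'a, 't) ses \<Rightarrow> nat \<Rightarrow> 't \<Rightarrow> nat \<Rightarrow> 's \<Rightarrow> real" where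
  "final_belief I S g' t' g = posterior (states I) (interim_belief I S g') (signal S g' t') g"

definition report_payoff ::
    "('s, 'a, 't) persuasion \<Rightarrow> ('s, 'a, 't) ses \<Rightarrow> 't \<Rightarrow> nat \<Rightarrow> 't \<Rightarrow> real" where
  "report_payoff I S t g' t' =
     (\<Sum>\<theta>\<in>states I. interim_belief I S g' \<theta> *
        (\<Sum>g\<in>signals S. pmf (signal S g' t' \<theta>) g * agent_util I t \<theta> (act S g' t' g)))"

text \<open>The action is optimal for the reported type, the report for the true type.\<close>

definition is_ses :: "('s, 'a, 't) persuasion \<Rightarrow> ('s, 'a, 't) ses \<Rightarrow> bool" where
  "is_ses I S \<longleftrightarrow>
     finite (pre_signals S) \<and> finite (signals S) \<and>
     (\<forall>\<theta>\<in>states I. set_pmf (pre_signal S \<theta>) \<subseteq> pre_signals S) \<and>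
     (\<forall>g'\<in>pre_signals S. \<forall>t'\<in>types I. \<forall>\<theta>\<in>states I.
        set_pmf (signal S g' t' \<theta>) \<subseteq> signals S) \<and>
     (\<forall>g'\<in>pre_signals S. \<forall>t'\<in>types I. \<forall>g\<in>signals S.
        is_arg_max
          (\<lambda>a. \<Sum>\<theta>\<in>states I. final_belief I S g' t' g \<theta> * agent_util I t' \<theta> a)
          (\<lambda>a. a \<in> actions I) (act S g' t' g)) \<and>
     (\<forall>t\<in>types I. \<forall>g'\<in>pre_signals S.
        is_arg_max (report_payoff I S t g') (\<lambda>t'. t' \<in> types I) (report S t g'))"

text \<open>Ex ante expectation of \<open>w \<theta> a\<close> when the agent's true type is \<open>t\<close>.\<close>

definition ses_expectation ::
    "('s, 'a, 't) persuasion \<Rightarrow> ('s, 'a, 't) ses \<Rightarrow> 't \<Rightarrow> ('s \<Rightarrow> 'a \<Rightarrow> real) \<Rightarrow> real" where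
  "ses_expectation I S t w =
     (\<Sum>\<theta>\<in>states I. pmf (prior I) \<theta> *
       (\<Sum>g'\<in>pre_signals S. pmf (pre_signal S \<theta>) g' *
         (\<Sum>g\<in>signals S. pmf (signal S g' (report S t g') \<theta>) g *
            w \<theta> (act S g' (report S t g') g))))"

definition ses_payoff :: "('s, 'a, 't) persuasion \<Rightarrow> ('s, 'a, 't) ses \<Rightarrow> real" where
  "ses_payoff I S =
     (\<Sum>t\<in>types I. pmf (type_dist I) t * ses_expectation I S t (principal_util I))"

text \<open>Non-binding elicitation in front: a menu of mechanisms as above. The choice of an option
  (field \<open>choice\<close>, indexed by the true type) does not constrain later behavior, so within every
  option each type follows the \<open>report\<close> of that option's own mechanism.\<close>

record ('s, 'a, 't) eses =
  menu :: "nat set"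
  option_ses :: "nat \<Rightarrow> ('s, 'a, 't) ses"
  choice :: "'t \<Rightarrow> nat"

definition is_eses :: "('s, 'a, 't) persuasion \<Rightarrow> ('s, 'a, 't) eses \<Rightarrow> bool" where
  "is_eses I M \<longleftrightarrow>
     finite (menu M) \<and> (\<forall>m\<in>menu M. is_ses I (option_ses M m)) \<and>
     (\<forall>t\<in>types I.
        is_arg_max (\<lambda>m. ses_expectation I (option_ses M m) t (agent_util I t))
          (\<lambda>m. m \<in> menu M) (choice M t))"

definition eses_payoff :: "('s, 'a, 't) persuasion \<Rightarrow> ('s, 'a, 't) eses \<Rightarrow> real" where
  "eses_payoff I M =
     (\<Sum>t\<in>types I. pmf (type_dist I) t *
        ses_expectation I (option_ses M (choice M t)) t (principal_util I))"

definition optimal_eses :: "('s, 'a, 't) persuasion \<Rightarrow> ('s, 'a, 't) eses \<Rightarrow> bool" where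
  "optimal_eses I M \<longleftrightarrow> is_arg_max (eses_payoff I) (is_eses I) M"

end

theory Submission
  imports Defs
begin

text \<open>The principal's payoff is an indicator, and the menu mechanism below attains the bound 1, so
  it is optimal. Type 0 does what the principal wants only if he learns in advance whether the
  state is 2: in state 2 he acts on his own behalf, in states 0 and 1 he gives up his own
  preference and reports the dummy type 2 (which has probability 0) in order to learn which of the
  two states holds. Type 1 must not learn that the state is 2, because he would then play action 6;
  the finer information of the second option about states 0 and 1 makes him forgo this knowledge.
  A single pre-signal cannot serve both: payoff 1 from type 0 forces some pre-signal to reveal
  state 2, and there type 1 plays action 6.\<close>

section \<open>The counterexample instance and its menu mechanism\<close>

definition gain :: "nat \<Rightarrow> nat \<Rightarrow> real" where
  "gain \<theta> a = of_bool (if \<theta> = 2 then a \<in> {0, 1, 4, 5} else a \<in> {2, 3, 4, 5})"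

lemma gain_eq_1_iff:
  "gain \<theta> a = 1 \<longleftrightarrow> (if \<theta> = 2 then a \<in> {0, 1, 4, 5} else a \<in> {2, 3, 4, 5})"
  unfolding gain_def by (rule of_bool_eq_1_iff)

text \<open>Blocks are types, rows states, columns actions. For type 0, actions 0 and 1 are opposite
  bets, and 2 and 3 are the same bets lowered by 1. For type 1, actions 4 and 5 are opposite bets on
  states 0 and 1 that lose in state 2, while 6 is safe with payoff 0. Type 2 prefers 2 and 3 to all
  else in every state.\<close>

definition utility :: "nat \<Rightarrow> nat \<Rightarrow> nat \<Rightarrow> real" where
  "utility t \<theta> a =
    [[[ 2, -2,  1, -3, -1, -1, -1],
      [-2,  2, -3,  1, -1, -1, -1],
      [ 0,  0, -1, -1, -1, -1, -1]],
     [[-1, -1, -1, -1,  2, -2,  0],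
      [-1, -1, -1, -1, -2,  2,  0],
      [-1, -1, -1, -1, -1, -1,  0]],
     [[-1, -1,  1,  0, -1, -1, -1],
      [-1, -1,  0,  1, -1, -1, -1],
      [-1, -1,  0,  0, -1, -1, -1]]] ! t ! \<theta> ! a"

definition inst :: "(nat, nat, nat) persuasion" where
  "inst = \<lparr>states = {0, 1, 2}, actions = {0, 1, 2, 3, 4, 5, 6}, types = {0, 1, 2},
     prior = pmf_of_set {0, 1, 2}, type_dist = pmf_of_set {0, 1},
     principal_util = gain, agent_util = utility\<rparr>"

text \<open>Only report 2 buys the distinction between states 0 and 1. After pre-signal 0 it earns
  type 0 the payoff 1, against 0 from the truthful report.\<close>

definition option_a :: "(nat, nat, nat) ses" where
  "option_a = \<lparr>pre_signals = {0, 1}, pre_signal = (\<lambda>\<theta>. return_pmf (if \<theta> = 2 then 1 else 0)),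
     signals = {0, 1},
     signal = (\<lambda>g' t' \<theta>. return_pmf (if t' = 2 \<and> \<theta> \<noteq> 0 then 1 else 0)),
     report = (\<lambda>t g'. if t = 0 \<and> g' = 0 then 2 else t),
     act = (\<lambda>g' t' g. if t' = 0 then 0 else if t' = 1 then 6 else 2 + g)\<rparr>"

text \<open>After report 1 the signal separates state 0 from the pool of states 1 and 2. In the pool
  action 5 has mean payoff (2 - 1) / 2 and beats the safe action 6, so type 1 plays 5 even in state
  2.\<close>

definition option_b :: "(nat, nat, nat) ses" where
  "option_b = \<lparr>pre_signals = {0}, pre_signal = (\<lambda>\<theta>. return_pmf 0),
     signals = {0, 1},
     signal = (\<lambda>g' t' \<theta>. return_pmf (if t' = 1 \<and> \<theta> \<noteq> 0 then 1 else 0)),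
     report = (\<lambda>t g'. t),
     act = (\<lambda>g' t' g. if t' = 0 then 0 else if t' = 1 then 4 + g else 2)\<rparr>"

definition menu_mech :: "(nat, nat, nat) eses" where
  "menu_mech = \<lparr>menu = {0, 1}, option_ses = (\<lambda>m. if m = 0 then option_a else option_b),
     choice = (\<lambda>t. if t = 1 then 1 else 0)\<rparr>"

lemma inst_simps [simp]:
  "states inst = {0, 1, 2}" "actions inst = {0, 1, 2, 3, 4, 5, 6}" "types inst = {0, 1, 2}"
  "prior inst = pmf_of_set {0, 1, 2}" "type_dist inst = pmf_of_set {0, 1}"
  "principal_util inst = gain" "agent_util inst = utility"
  by (simp_all add: inst_def)

text \<open>Written with \<open>if\<close> so that case distinctions evaluate the deterministic
  signals; it replaces \<open>pmf_return\<close> below.\<close>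

lemma pmf_return_if: "pmf (return_pmf x) y = (if y = x then 1 else 0)"
  by simp

lemma option_a_simps:
  "pre_signals option_a = {0, 1}" "pre_signal option_a \<theta> = return_pmf (if \<theta> = 2 then 1 else 0)"
  "signals option_a = {0, 1}"
  "signal option_a g' t' \<theta> = return_pmf (if t' = 2 \<and> \<theta> \<noteq> 0 then 1 else 0)"
  "report option_a t g' = (if t = 0 \<and> g' = 0 then 2 else t)"
  "act option_a g' t' g = (if t' = 0 then 0 else if t' = 1 then 6 else 2 + g)"
  by (simp_all add: option_a_def)

lemma option_b_simps:
  "pre_signals option_b = {0}" "pre_signal option_b \<theta> = return_pmf 0"
  "signals option_b = {0, 1}"
  "signal option_b g' t' \<theta> = return_pmf (if t' = 1 \<and> \<theta> \<noteq> 0 then 1 else 0)"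
  "report option_b t g' = t"
  "act option_b g' t' g = (if t' = 0 then 0 else if t' = 1 then 4 + g else 2)"
  by (simp_all add: option_b_def)

lemma persuasion_instance_inst: "persuasion_instance inst"
  by (simp add: persuasion_instance_def)

lemma is_ses_option_a: "is_ses inst option_a"
  unfolding is_ses_def
  by (simp add: is_arg_max_linorder option_a_simps final_belief_def interim_belief_def
      posterior_def report_payoff_def utility_def pmf_return_if del: pmf_return)

lemma is_ses_option_b: "is_ses inst option_b"
  unfolding is_ses_def
  by (simp add: is_arg_max_linorder option_b_simps final_belief_def interim_belief_def
      posterior_def report_payoff_def utility_def pmf_return_if del: pmf_return)

lemma ses_expectation_option_a:
  "ses_expectation inst option_a 0 w = (w 0 2 + w 1 3 + w 2 0) / 3"
  "ses_expectation inst option_a 1 w = (w 0 6 + w 1 6 + w 2 6) / 3"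
  "ses_expectation inst option_a 2 w = (w 0 2 + w 1 3 + w 2 3) / 3"
  by (simp_all add: ses_expectation_def option_a_simps pmf_return_if eval_nat_numeral del: pmf_return)

lemma ses_expectation_option_b:
  "ses_expectation inst option_b 0 w = (w 0 0 + w 1 0 + w 2 0) / 3"
  "ses_expectation inst option_b 1 w = (w 0 4 + w 1 5 + w 2 5) / 3"
  "ses_expectation inst option_b 2 w = (w 0 2 + w 1 2 + w 2 2) / 3"
  by (simp_all add: ses_expectation_def option_b_simps pmf_return_if eval_nat_numeral del: pmf_return)

lemmas ses_expectation_menu = ses_expectation_option_a ses_expectation_option_b

text \<open>All choices are strict: \<open>option_a\<close> and \<open>option_b\<close> give type 0
  the payoffs 2/3 and 0, type 1 the payoffs 0 and 1, type 2 the payoffs 2/3 and 1/3.\<close>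

lemma is_eses_menu_mech: "is_eses inst menu_mech"
  using is_ses_option_a is_ses_option_b
  by (simp add: is_eses_def menu_mech_def is_arg_max_linorder utility_def
      ses_expectation_menu ses_expectation_menu[unfolded One_nat_def])

lemma eses_payoff_menu_mech: "eses_payoff inst menu_mech = 1"
  by (simp add: eses_payoff_def menu_mech_def gain_def
      ses_expectation_menu ses_expectation_menu[unfolded One_nat_def])

section \<open>Averages that attain their upper bound\<close>

lemma weighted_sum_le_1:
  fixes w x :: "'b \<Rightarrow> real"
  assumes "\<And>i. i \<in> A \<Longrightarrow> 0 \<le> w i" "sum w A \<le> 1" "\<And>i. i \<in> A \<Longrightarrow> x i \<le> 1"
  shows "(\<Sum>i\<in>A. w i * x i) \<le> 1"
proof -
  have "(\<Sum>i\<in>A. w i * x i) \<le> sum w A"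
    using assms by (intro sum_mono) (simp add: mult_left_le)
  then show ?thesis using assms(2) by simp
qed

text \<open>A positively weighted term below 1 would push the sum strictly below the total weight,
  hence below 1.\<close>

lemma weighted_sum_eq_1D:
  fixes w x :: "'b \<Rightarrow> real"
  assumes "finite A" "\<And>i. i \<in> A \<Longrightarrow> 0 \<le> w i" "sum w A \<le> 1" "\<And>i. i \<in> A \<Longrightarrow> x i \<le> 1"
    and "1 \<le> (\<Sum>i\<in>A. w i * x i)" "i \<in> A" "0 < w i"
  shows "1 \<le> x i"
proof (rule ccontr)
  assume "\<not> 1 \<le> x i"
  then have "(\<Sum>i\<in>A. w i * x i) < sum w A"
    using assms by (intro sum_strict_mono_ex1) (auto simp: mult_left_le intro!: bexI[of _ i])
  then show False using assms by simp
qed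

lemma sum_pmf_le_1: "sum (pmf p) A \<le> 1"
  by (cases "finite A") (simp_all flip: measure_measure_pmf_finite)

context
  fixes I :: "('s, 'a, 't) persuasion" and w :: "'s \<Rightarrow> 'a \<Rightarrow> real"
  assumes w: "\<And>\<theta> a. w \<theta> a \<le> 1"
begin

lemma ses_expectation_le_1: "ses_expectation I S t w \<le> 1"
  unfolding ses_expectation_def by (intro weighted_sum_le_1 sum_pmf_le_1 pmf_nonneg w)

text \<open>The expectation nests three averages, over states, pre-signals and signals;
  \<open>weighted_sum_eq_1D\<close> peels off one at a time.\<close>

lemma ses_expectation_eq_1D:
  assumes "persuasion_instance I" "is_ses I S" "1 \<le> ses_expectation I S t w"
    and "\<theta> \<in> states I" "0 < pmf (prior I) \<theta>" "g' \<in> pre_signals S" "0 < pmf (pre_signal S \<theta>) g'"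
    and "g \<in> signals S" "0 < pmf (signal S g' (report S t g') \<theta>) g"
  shows "1 \<le> w \<theta> (act S g' (report S t g') g)"
proof -
  note fin = assms(1,2)[unfolded persuasion_instance_def is_ses_def]
  note bound = weighted_sum_le_1 sum_pmf_le_1 pmf_nonneg w
  have "1 \<le> (\<Sum>g'\<in>pre_signals S. pmf (pre_signal S \<theta>) g' *
         (\<Sum>g\<in>signals S. pmf (signal S g' (report S t g') \<theta>) g *
            w \<theta> (act S g' (report S t g') g)))"
    by (rule weighted_sum_eq_1D[OF _ _ _ _ assms(3)[unfolded ses_expectation_def]])
      (use fin assms in \<open>auto intro!: bound\<close>)
  then have "1 \<le> (\<Sum>g\<in>signals S. pmf (signal S g' (report S t g') \<theta>) g *
            w \<theta> (act S g' (report S t g') g))"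
    by (rule weighted_sum_eq_1D[rotated 4]) (use fin assms in \<open>auto intro!: bound\<close>)
  then show ?thesis
    by (rule weighted_sum_eq_1D[rotated 4]) (use fin assms in \<open>auto intro!: bound\<close>)
qed

end

section \<open>Unnormalized posteriors and optimal actions\<close>

lemma interim_belief_nonneg: "0 \<le> interim_belief I S g' \<theta>"
  by (simp add: interim_belief_def posterior_def sum_nonneg)

text \<open>The joint probability of state and signal given the pre-signal, that is,
  \<open>final_belief\<close> before normalization. Report payoffs are linear in it.\<close>

definition mass :: "(nat, nat, nat) ses \<Rightarrow> nat \<Rightarrow> nat \<Rightarrow> nat \<Rightarrow> nat \<Rightarrow> real" where
  "mass S g' t g \<theta> = interim_belief inst S g' \<theta> * pmf (signal S g' t \<theta>) g"

lemma mass_nonneg: "0 \<le> mass S g' t g \<theta>"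
  by (simp add: mass_def interim_belief_nonneg)

text \<open>Multiplying by the probability of the signal covers unreachable signals as well.\<close>

lemma act_optimal:
  assumes "is_ses inst S" "g' \<in> pre_signals S" "t \<in> types inst" "g \<in> signals S"
    and "a \<in> actions inst"
  shows "(\<Sum>\<theta>\<in>{0, 1, 2}. mass S g' t g \<theta> * utility t \<theta> a)
    \<le> (\<Sum>\<theta>\<in>{0, 1, 2}. mass S g' t g \<theta> * utility t \<theta> (act S g' t g))"
proof -
  define Z where "Z = (\<Sum>\<theta>\<in>{0, 1, 2}. mass S g' t g \<theta>)"
  have belief: "final_belief inst S g' t g \<theta> = mass S g' t g \<theta> / Z" for \<theta>
    by (simp add: final_belief_def posterior_def mass_def Z_def)
  have opt: "(\<Sum>\<theta>\<in>{0, 1, 2}. mass S g' t g \<theta> / Z * utility t \<theta> a)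
    \<le> (\<Sum>\<theta>\<in>{0, 1, 2}. mass S g' t g \<theta> / Z * utility t \<theta> (act S g' t g))"
    using assms unfolding is_ses_def is_arg_max_linorder belief[symmetric] inst_simps by blast
  have "0 \<le> Z" unfolding Z_def by (intro sum_nonneg mass_nonneg)
  show ?thesis
  proof (cases "Z = 0")
    case True
    then have "mass S g' t g \<theta> = 0" if "\<theta> \<in> {0, 1, 2}" for \<theta>
      using that unfolding Z_def by (subst (asm) sum_nonneg_eq_0_iff) (auto simp: mass_nonneg)
    then show ?thesis by simp
  next
    case False
    with \<open>0 \<le> Z\<close> have "0 < Z" by simp
    moreover have "(\<Sum>\<theta>\<in>{0, 1, 2}. mass S g' t g \<theta> / Z * f \<theta>)
        = (\<Sum>\<theta>\<in>{0, 1, 2}. mass S g' t g \<theta> * f \<theta>) / Z" for f :: "nat \<Rightarrow> real"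
      by (simp add: add_divide_distrib)
    ultimately show ?thesis using opt by (simp only: divide_le_cancel)
  qed
qed

lemma act_in_actions:
  assumes "is_ses inst S" "g' \<in> pre_signals S" "t \<in> types inst" "g \<in> signals S"
  shows "act S g' t g \<in> actions inst"
  using assms unfolding is_ses_def is_arg_max_linorder by blast

text \<open>Each reported type has strictly dominated actions. For type 0, actions 0 and 1 beat 2
  and 3 by 1, and the better of them gets at least 0 where 4, 5, 6 get -1. For type 1, action 6
  beats 0 to 3 by 1. For type 2, everything except 2 and 3 yields -1.\<close>

lemma own_action:
  assumes "is_ses inst S" "g' \<in> pre_signals S" "t \<in> types inst" "g \<in> signals S"
    and pos: "0 < mass S g' t g \<theta>" "\<theta> \<in> states inst"
  shows "act S g' t g \<in> (if t = 0 then {0, 1} else if t = 1 then {4, 5, 6} else {2, 3})"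
proof -
  note opt = act_optimal[OF assms(1-4)]
  have nonneg: "0 \<le> mass S g' t g 0" "0 \<le> mass S g' t g 1" "0 \<le> mass S g' t g 2"
    by (simp_all only: mass_nonneg)
  \<comment> \<open>Positive total mass keeps these dominations strict after weighting.\<close>
  have "0 < mass S g' t g 0 + mass S g' t g 1 + mass S g' t g 2"
    using pos nonneg by auto
  then show ?thesis
    using assms(3) act_in_actions[OF assms(1-4)] nonneg opt[of 0] opt[of 1] opt[of 2] opt[of 3] opt[of 6]
    by (auto simp: utility_def)
qed

section \<open>Payoffs from truthful and untruthful reports\<close>

lemma report_payoff_mass:
  "report_payoff inst S t g' t' =
    (\<Sum>g\<in>signals S. \<Sum>\<theta>\<in>{0, 1, 2}. mass S g' t' g \<theta> * utility t \<theta> (act S g' t' g))"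
  unfolding report_payoff_def inst_simps
  by (subst sum.swap) (simp add: sum_distrib_left mass_def mult.assoc)

text \<open>At every signal type 1 can secure 0 by action 6. For type 0 the utilities of actions 0
  and 1 are negatives of each other, so the better one yields at least 0.\<close>

lemma own_report_payoff_nonneg:
  assumes "is_ses inst S" "g' \<in> pre_signals S" "t \<in> {0, 1}"
  shows "0 \<le> report_payoff inst S t g' t"
  unfolding report_payoff_mass
proof (rule sum_nonneg)
  fix g assume "g \<in> signals S"
  then show "0 \<le> (\<Sum>\<theta>\<in>{0, 1, 2}. mass S g' t g \<theta> * utility t \<theta> (act S g' t g))"
    using assms act_optimal[of S g' t g 0] act_optimal[of S g' t g 1] act_optimal[of S g' t g 6]
    by (auto simp: utility_def)
qed

lemma sum_mass:
  assumes "is_ses inst S" "g' \<in> pre_signals S" "t \<in> types inst" "\<theta> \<in> states inst"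
  shows "(\<Sum>g\<in>signals S. mass S g' t g \<theta>) = interim_belief inst S g' \<theta>"
proof -
  have "(\<Sum>g\<in>signals S. pmf (signal S g' t \<theta>) g) = 1"
    using assms unfolding is_ses_def by (intro sum_pmf_eq_1) auto
  then show ?thesis by (simp add: mass_def flip: sum_distrib_left)
qed

text \<open>If every reachable outcome pays -1, the payoff is minus the total interim belief.
  Combined with \<open>own_report_payoff_nonneg\<close>, this rules out reports as
  suboptimal.\<close>

lemma report_payoff_neg:
  assumes "is_ses inst S" "g' \<in> pre_signals S" "t' \<in> types inst"
    and pos: "0 < interim_belief inst S g' 2"
    and bad: "\<And>g \<theta>. g \<in> signals S \<Longrightarrow> \<theta> \<in> states inst \<Longrightarrow> 0 < mass S g' t' g \<theta>
      \<Longrightarrow> utility t \<theta> (act S g' t' g) = -1"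
  shows "report_payoff inst S t g' t' < 0"
proof -
  have "mass S g' t' g \<theta> * utility t \<theta> (act S g' t' g) = - mass S g' t' g \<theta>"
    if "g \<in> signals S" "\<theta> \<in> {0, 1, 2}" for g \<theta>
    using bad[of g \<theta>] mass_nonneg[of S g' t' g \<theta>] that by (cases "mass S g' t' g \<theta> = 0") auto
  then have "report_payoff inst S t g' t' = (\<Sum>g\<in>signals S. \<Sum>\<theta>\<in>{0, 1, 2}. - mass S g' t' g \<theta>)"
    unfolding report_payoff_mass by (intro sum.cong) auto
  also have "\<dots> = (\<Sum>\<theta>\<in>{0, 1, 2}. - interim_belief inst S g' \<theta>)"
    using assms by (subst sum.swap) (simp add: sum_negf sum_mass)
  also have "\<dots> < 0"
    using pos interim_belief_nonneg[of inst S g' 0] interim_belief_nonneg[of inst S g' 1] by simp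
  finally show ?thesis .
qed

section \<open>The strict bound without a menu\<close>

lemma ses_payoff_less_1:
  assumes S: "is_ses inst S"
  shows "ses_payoff inst S < 1"
proof (rule ccontr)
  assume payoff: "\<not> ses_payoff inst S < 1"
  have gain_le: "gain \<theta> a \<le> 1" for \<theta> a by (simp add: gain_def)
  \<comment> \<open>Types 0 and 1 have weight 1/2 each and expectations at most 1, so neither can
    fall short.\<close>
  have full: "1 \<le> ses_expectation inst S t gain" if "t \<in> {0, 1}" for t
    using that payoff ses_expectation_le_1[of gain inst S 0, OF gain_le]
      ses_expectation_le_1[of gain inst S 1, OF gain_le]
    by (auto simp: ses_payoff_def)
  have sub: "set_pmf (pre_signal S 2) \<subseteq> pre_signals S" using S by (simp add: is_ses_def)
  obtain g' where g'_set: "g' \<in> set_pmf (pre_signal S 2)" using set_pmf_not_empty by fast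
  with sub have g': "g' \<in> pre_signals S" by blast
  have g'_pos: "0 < pmf (pre_signal S 2) g'" using g'_set by (rule pmf_positive)
  \<comment> \<open>The uniform prior cancels in Bayes' rule and leaves \<open>N\<close> as
    normalizer.\<close>
  define N where "N = (\<Sum>\<theta>\<in>{0, 1, 2}. pmf (pre_signal S \<theta>) g')"
  have "0 < N" using g'_pos by (simp add: N_def add_nonneg_pos)
  have belief: "interim_belief inst S g' \<theta> = pmf (pre_signal S \<theta>) g' / N" if "\<theta> \<in> {0, 1, 2}" for \<theta>
    using that by (auto simp: interim_belief_def posterior_def N_def field_simps)
  have belief2: "0 < interim_belief inst S g' 2" using g'_pos \<open>0 < N\<close> by (simp add: belief)
  have report: "report S t g' \<in> types inst"
    "t' \<in> types inst \<Longrightarrow> report_payoff inst S t g' t' \<le> report_payoff inst S t g' (report S t g')"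
    if "t \<in> types inst" for t t'
    using S g' that unfolding is_ses_def is_arg_max_linorder by blast+
  have good: "gain \<theta> (act S g' (report S t g') g) = 1"
    if "t \<in> {0, 1}" "\<theta> \<in> {0, 1, 2}" "g \<in> signals S" "0 < mass S g' (report S t g') g \<theta>" for t \<theta> g
  proof -
    have "pmf (pre_signal S \<theta>) g' \<noteq> 0" "pmf (signal S g' (report S t g') \<theta>) g \<noteq> 0"
      using that belief[of \<theta>] by (auto simp: mass_def)
    then have "1 \<le> gain \<theta> (act S g' (report S t g') g)"
      using that g' by (intro ses_expectation_eq_1D[OF gain_le persuasion_instance_inst S full[of t]])
        (auto simp: pmf_pos)
    then show ?thesis using gain_le[of \<theta>] by (meson order_antisym)
  qed
  have ex: "\<exists>g\<in>signals S. 0 < mass S g' t g \<theta>"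
    if "t \<in> types inst" "\<theta> \<in> states inst" "0 < interim_belief inst S g' \<theta>" for t \<theta>
    using sum_mass[OF S g' that(1,2)] that(3) sum_nonpos[of "signals S" "\<lambda>g. mass S g' t g \<theta>"]
    by (metis not_less)
  define r where "r = report S 0 g'"
  have r_types: "r \<in> {0, 1, 2}" using report[of 0] by (simp add: r_def)
  \<comment> \<open>Report 2 leads to action 2 or 3, which has no gain in state 2.\<close>
  have "r \<noteq> 2"
  proof
    assume "r = 2"
    with ex[of 2 2] belief2 obtain g where "g \<in> signals S" "0 < mass S g' r g 2" by auto
    then show False
      using own_action[OF S g', of r g 2] good[of 0 2 g] \<open>r = 2\<close> by (auto simp: r_def gain_eq_1_iff)
  qed
  \<comment> \<open>Report 1 leads to action 4, 5 or 6, each worth -1 to type 0 in every state, so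
    truth is better.\<close>
  moreover have "r \<noteq> 1"
  proof
    assume "r = 1"
    have "report_payoff inst S 0 g' 1 < 0"
    proof (rule report_payoff_neg[OF S g' _ belief2])
      fix g \<theta> assume "g \<in> signals S" "\<theta> \<in> states inst" "0 < mass S g' 1 g \<theta>"
      then show "utility 0 \<theta> (act S g' 1 g) = -1"
        using own_action[OF S g', of 1 g \<theta>] by (auto simp: utility_def)
    qed simp
    then show False
      using own_report_payoff_nonneg[OF S g', of 0] report(2)[of 0 0] \<open>r = 1\<close> by (simp add: r_def)
  qed
  ultimately have "r = 0" using r_types by simp
  have belief01: "interim_belief inst S g' \<theta> = 0" if "\<theta> \<in> {0, 1}" for \<theta>
  proof (rule ccontr)
    assume "interim_belief inst S g' \<theta> \<noteq> 0"
    then have "0 < interim_belief inst S g' \<theta>"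
      using interim_belief_nonneg[of inst S g' \<theta>] by simp
    with ex[of 0 \<theta>] that obtain g where "g \<in> signals S" "0 < mass S g' 0 g \<theta>" by auto
    then show False
      using own_action[OF S g', of 0 g \<theta>] good[of 0 \<theta> g] that \<open>r = 0\<close> by (auto simp: r_def gain_eq_1_iff)
  qed
  \<comment> \<open>In state 2 the actions with gain 1 are 0, 1, 4 and 5, and each is worth -1 to
    type 1.\<close>
  have "report_payoff inst S 1 g' (report S 1 g') < 0"
  proof (rule report_payoff_neg[OF S g' _ belief2])
    show "report S 1 g' \<in> types inst" using report by simp
    fix g \<theta> assume g: "g \<in> signals S" "\<theta> \<in> states inst" "0 < mass S g' (report S 1 g') g \<theta>"
    then have "\<theta> = 2" using belief01[of \<theta>] by (auto simp: mass_def)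
    then show "utility 1 \<theta> (act S g' (report S 1 g') g) = -1"
      using good[of 1 \<theta> g] g by (auto simp: gain_eq_1_iff utility_def)
  qed
  then show False
    using own_report_payoff_nonneg[OF S g', of 1] report(2)[of 1 1] by simp
qed

lemma eses_payoff_le_1: "eses_payoff inst M \<le> 1"
proof -
  have "ses_expectation inst S t gain \<le> 1" for S t
    by (rule ses_expectation_le_1) (simp add: gain_def)
  then show ?thesis
    unfolding eses_payoff_def inst_simps
    by (intro weighted_sum_le_1 sum_pmf_le_1 pmf_nonneg)
qed

theorem theorem7:
  "\<exists>(I :: (nat, nat, nat) persuasion) (M :: (nat, nat, nat) eses).
     persuasion_instance I \<and> optimal_eses I M \<and>
     (\<forall>S. is_ses I S \<longrightarrow> ses_payoff I S < eses_payoff I M)"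
proof (intro exI conjI)
  show "persuasion_instance inst" by (rule persuasion_instance_inst)
  show "optimal_eses inst menu_mech"
    using is_eses_menu_mech eses_payoff_le_1
    by (simp add: optimal_eses_def is_arg_max_linorder eses_payoff_menu_mech)
  show "\<forall>S. is_ses inst S \<longrightarrow> ses_payoff inst S < eses_payoff inst menu_mech"
    using ses_payoff_less_1 by (simp add: eses_payoff_menu_mech)
qed

end
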